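(* Let $P$ be a convex equal-area $n$-gon. Every cusp of a parallel polygon of $P$ belongs to the affine evolute of $P$; that is, if $\lambda\in\mathbb{R}$ and the vertex $P_i(\lambda)$ of the $\lambda$-parallel polygon $P(\lambda)$ is a cusp, then $P_i(\lambda)$ lies on the affine evolute of $P$.
   Context: $[u,v]$ denotes the determinant of two plane vectors. Let $P$ be a polygon with vertices $P_1,\dots,P_n\in\mathbb{R}^2$, $n\ge5$, all indices taken modulo $n$, and oriented sides $\mathbf{v}_{i+\frac12}=P_{i+1}-P_i$. $P$ is a convex equal-area $n$-gon if it is a simple polygon bounding a convex planar domain, no three consecutive vertices are collinear, and $[\mathbf{v}_{i-\frac12},\mathbf{v}_{i+\frac12}]=[\mathbf{v}_{i+\frac12},\mathbf{v}_{i+\frac32}]$ for every $i$; it is normalized, by an affine transformation, so that this common determinant equals $1$. The affine normal vector at $P_i$ is $\mathbf{n}_i=\mathbf{v}_{i+\frac12}-\mathbf{v}_{i-\frac12}$, and the discrete affine curvature $\mu_{i+\frac12}$ is defined by $\mathbf{n}_{i+1}-\mathbf{n}_i=-\mu_{i+\frac12}\mathbf{v}_{i+\frac12}$. For $\lambda\in\mathbb{R}$ put $P_i(\lambda)=P_i+\lambda\mathbf{n}_i$; the line $\{P_i(\lambda):\lambda\in\mathbb{R}\}$ is the affine normal line at $P_i$. The $\lambda$-parallel polygon $P(\lambda)$ has vertices $P_i(\lambda)$ and edges $\mathbf{v}_{i+\frac12}(\lambda)=P_{i+1}(\lambda)-P_i(\lambda)=(1-\lambda\mu_{i+\frac12})\mathbf{v}_{i+\frac12}$.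 The vertex $P_i(\lambda)$ is a cusp of $P(\lambda)$ if $[\mathbf{v}_{i-\frac12},\mathbf{v}_{i+\frac12}]$ and $[\mathbf{v}_{i-\frac12}(\lambda),\mathbf{v}_{i+\frac12}(\lambda)]$ have different (strictly opposite) signs, equivalently $(1-\lambda\mu_{i-\frac12})(1-\lambda\mu_{i+\frac12})<0$. When $\mu_{i+\frac12}\ne0$, the node $Q_{i+\frac12}=P_i+\frac1{\mu_{i+\frac12}}\mathbf{n}_i=P_{i+1}+\frac1{\mu_{i+\frac12}}\mathbf{n}_{i+1}$ is the intersection of the normal lines at $P_i$ and $P_{i+1}$. The edge $\mathbf{e}_i$ is the subset of the normal line at $P_i$ with boundary $\{Q_{i-\frac12},Q_{i+\frac12}\}$ that does not contain $P_i$: it is the closed segment $\overline{Q_{i-\frac12}Q_{i+\frac12}}$ if $\mu_{i-\frac12}\mu_{i+\frac12}>0$, the complement of (the interior of) this segment in the normal line if $\mu_{i-\frac12}\mu_{i+\frac12}<0$, the closed half-line starting at the unique existing node and not containing $P_i$ if exactly one of $\mu_{i-\frac12},\mu_{i+\frac12}$ is zero, and empty if both are zero. The affine evolute of $P$ is the graph with nodes $Q_{i+\frac12}$ and edges $\mathbf{e}_i$. *)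

theory Defs
  imports "HOL-Analysis.Analysis"
begin

definition bracket :: "real^2 \<Rightarrow> real^2 \<Rightarrow> real" where
  "bracket u v = det (vector [u, v] :: real^2^2)"

text \<open>
  A closed polygon with vertices indexed modulo \<open>n\<close> is an \<open>n\<close>-periodic function on the integers.
  A quantity with half-integer index \<open>i + 1/2\<close> is attached to the index \<open>i\<close>; hence
  the index \<open>i - 1/2\<close> becomes \<open>i - 1\<close>.
\<close>

type_synonym polygon = "int \<Rightarrow> real^2"

definition closed_polygon :: "nat \<Rightarrow> polygon \<Rightarrow> bool" where
  "closed_polygon n P \<longleftrightarrow> (\<forall>i. P (i + int n) = P i)"

definition side_vec :: "polygon \<Rightarrow> int \<Rightarrow> real^2" where
  "side_vec P i = P (i + 1) - P i"

definition side_seg :: "polygon \<Rightarrow> int \<Rightarrow> (real^2) set" where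
  "side_seg P i = closed_segment (P i) (P (i + 1))"

definition simple_polygon :: "nat \<Rightarrow> polygon \<Rightarrow> bool" where
  "simple_polygon n P \<longleftrightarrow>
     closed_polygon n P \<and>
     (\<forall>i. P i \<noteq> P (i + 1)) \<and>
     (\<forall>i. side_seg P i \<inter> side_seg P (i + 1) = {P (i + 1)}) \<and>
     (\<forall>i j. i mod int n \<noteq> j mod int n \<and>
            (i + 1) mod int n \<noteq> j mod int n \<and>
            (j + 1) mod int n \<noteq> i mod int n \<longrightarrow>
            side_seg P i \<inter> side_seg P j = {})"

text \<open>The domain bounded by a simple polygon is the \<^const>\<open>inside\<close> of the union of its sides.\<close>

definition convex_polygon :: "nat \<Rightarrow> polygon \<Rightarrow> bool" where
  "convex_polygon n P \<longleftrightarrow> simple_polygon n P \<and> convex (inside (\<Union>i. side_seg P i))"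

definition convex_equal_area :: "nat \<Rightarrow> polygon \<Rightarrow> bool" where
  "convex_equal_area n P \<longleftrightarrow>
     5 \<le> n \<and>
     convex_polygon n P \<and>
     (\<forall>i. \<not> collinear {P (i - 1), P i, P (i + 1)}) \<and>
     (\<forall>i. bracket (side_vec P (i - 1)) (side_vec P i)
        = bracket (side_vec P i) (side_vec P (i + 1)))"

definition normalized :: "polygon \<Rightarrow> bool" where
  "normalized P \<longleftrightarrow> (\<forall>i. bracket (side_vec P (i - 1)) (side_vec P i) = 1)"

definition affine_normal :: "polygon \<Rightarrow> int \<Rightarrow> real^2" where
  "affine_normal P i = side_vec P i - side_vec P (i - 1)"

text \<open>For a \<^const>\<open>convex_equal_area\<close> polygon the number described here exists and is unique.\<close>

definition affine_curvature :: "polygon \<Rightarrow> int \<Rightarrow> real" where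
  "affine_curvature P i =
     (THE m. affine_normal P (i + 1) - affine_normal P i = - (m *\<^sub>R side_vec P i))"

definition parallel_polygon :: "polygon \<Rightarrow> real \<Rightarrow> polygon" where
  "parallel_polygon P l = (\<lambda>i. P i + l *\<^sub>R affine_normal P i)"

definition normal_line :: "polygon \<Rightarrow> int \<Rightarrow> (real^2) set" where
  "normal_line P i = range (\<lambda>l. parallel_polygon P l i)"

definition is_cusp :: "polygon \<Rightarrow> real \<Rightarrow> int \<Rightarrow> bool" where
  "is_cusp P l i \<longleftrightarrow>
     bracket (side_vec P (i - 1)) (side_vec P i) *
     bracket (side_vec (parallel_polygon P l) (i - 1)) (side_vec (parallel_polygon P l) i) < 0"

text \<open>Only meaningful if \<open>affine_curvature P i \<noteq> 0\<close>.\<close>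

definition evolute_node :: "polygon \<Rightarrow> int \<Rightarrow> real^2" where
  "evolute_node P i = P i + (1 / affine_curvature P i) *\<^sub>R affine_normal P i"

text \<open>The closed half-line with endpoint \<open>q\<close> pointing away from \<open>p\<close>.\<close>

definition ray_away :: "real^2 \<Rightarrow> real^2 \<Rightarrow> (real^2) set" where
  "ray_away p q = {q + t *\<^sub>R (q - p) | t. 0 \<le> t}"

definition evolute_edge :: "polygon \<Rightarrow> int \<Rightarrow> (real^2) set" where
  "evolute_edge P i =
     (let a = affine_curvature P (i - 1); b = affine_curvature P i;
          A = evolute_node P (i - 1); B = evolute_node P i
      in if a * b > 0 then closed_segment A B
         else if a * b < 0 then normal_line P i - open_segment A B
         else if a \<noteq> 0 then ray_away (P i) A
         else if b \<noteq> 0 then ray_away (P i) B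
         else {})"

text \<open>The plane point set formed by the nodes and edges of the evolute graph.\<close>

definition affine_evolute :: "polygon \<Rightarrow> (real^2) set" where
  "affine_evolute P =
     {evolute_node P i | i. affine_curvature P i \<noteq> 0} \<union> (\<Union>i. evolute_edge P i)"

end

theory Submission
  imports Defs
begin

text \<open>
  On the normal line at \<open>P\<^sub>i\<close>, with affine coordinate \<open>l\<close>, the vertex \<open>P\<^sub>i\<close> sits at \<open>0\<close> and the two nodes
  sit at \<open>1/a\<close> and \<open>1/b\<close>, where \<open>a\<close> and \<open>b\<close> are the curvatures of the sides meeting at \<open>P\<^sub>i\<close>.
  Since each parallel side is the original one scaled by \<open>1 - l * a\<close> resp. \<open>1 - l * b\<close>, a cusp at \<open>l\<close>
  means \<open>(1 - l * a) * (1 - l * b) < 0\<close>, which describes the interior of the part of the line with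
  boundary \<open>{1/a, 1/b}\<close> that does not contain \<open>0\<close>.
  A zero curvature moves its node to infinity.
\<close>

lemma bracket_eq: "bracket u v = u $ 1 * v $ 2 - u $ 2 * v $ 1"
  by (simp add: bracket_def det_2)

lemma bracket_scaleR: "bracket (r *\<^sub>R u) (s *\<^sub>R v) = r * s * bracket u v"
  by (simp add: bracket_eq algebra_simps)

lemma bracket_eq_0_imp_scaleR:
  assumes "bracket u v = 0" "v \<noteq> 0"
  obtains m where "u = m *\<^sub>R v"
proof (cases "v $ 1 = 0")
  case True
  then have "v $ 2 \<noteq> 0"
    using assms(2) by (simp add: vec_eq_iff forall_2)
  then have "u = (u $ 2 / v $ 2) *\<^sub>R v"
    using assms(1) True by (simp add: bracket_eq vec_eq_iff forall_2)
  then show ?thesis by (rule that)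
next
  case False
  then have "u = (u $ 1 / v $ 1) *\<^sub>R v"
    using assms(1) by (simp add: bracket_eq vec_eq_iff forall_2 field_simps)
  then show ?thesis by (rule that)
qed

lemma normalized_bracket:
  assumes "normalized P"
  shows "bracket (side_vec P (i - 1)) (side_vec P i) = 1"
  using assms by (simp add: normalized_def)

lemma normalized_side_vec_nonzero:
  assumes "normalized P"
  shows "side_vec P i \<noteq> 0"
  using normalized_bracket[OF assms, of i] by (auto simp: bracket_eq)

lemma normalized_affine_normal_nonzero:
  assumes "normalized P"
  shows "affine_normal P i \<noteq> 0"
proof
  assume "affine_normal P i = 0"
  then show False
    using normalized_bracket[OF assms, of i] by (simp add: affine_normal_def bracket_eq)
qed

text \<open>The brackets at the two ends of side \<open>i\<close> agree, so the second difference of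
  the side vectors has zero bracket with \<open>side_vec P i\<close> and is a multiple of it. As
  that side vector is nonzero, the multiple is unique, and the \<open>THE\<close> is well
  defined.\<close>

lemma affine_normal_diff:
  assumes "normalized P"
  shows "affine_normal P (i + 1) - affine_normal P i = - (affine_curvature P i *\<^sub>R side_vec P i)"
proof -
  let ?d = "affine_normal P (i + 1) - affine_normal P i"
  have "bracket ?d (side_vec P i) = 0"
    using normalized_bracket[OF assms, of i] normalized_bracket[OF assms, of "i + 1"]
    by (simp add: affine_normal_def bracket_eq algebra_simps)
  then obtain m where m: "?d = m *\<^sub>R side_vec P i"
    using normalized_side_vec_nonzero[OF assms] bracket_eq_0_imp_scaleR by metis
  show ?thesis
    unfolding affine_curvature_def
  proof (rule theI[where a = "- m"])
    show "?d = - (- m *\<^sub>R side_vec P i)"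
      using m by simp
    show "x = - m" if "?d = - (x *\<^sub>R side_vec P i)" for x
    proof -
      have "(m + x) *\<^sub>R side_vec P i = 0"
        unfolding scaleR_left_distrib m[symmetric] that by simp
      then show ?thesis
        using normalized_side_vec_nonzero[OF assms, of i] by simp
    qed
  qed
qed

lemma side_vec_parallel_polygon:
  assumes "normalized P"
  shows "side_vec (parallel_polygon P l) i = (1 - l * affine_curvature P i) *\<^sub>R side_vec P i"
proof -
  have "side_vec (parallel_polygon P l) i
      = side_vec P i + l *\<^sub>R (affine_normal P (i + 1) - affine_normal P i)"
    by (simp add: side_vec_def parallel_polygon_def algebra_simps)
  also have "\<dots> = (1 - l * affine_curvature P i) *\<^sub>R side_vec P i"
    unfolding affine_normal_diff[OF assms] by (simp add: algebra_simps)
  finally show ?thesis .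
qed

lemma is_cusp_iff:
  assumes "normalized P"
  shows "is_cusp P l i \<longleftrightarrow>
    (1 - l * affine_curvature P (i - 1)) * (1 - l * affine_curvature P i) < 0"
  by (simp add: is_cusp_def side_vec_parallel_polygon[OF assms] bracket_scaleR
      normalized_bracket[OF assms])

text \<open>A node is defined from the initial vertex of its side. Passing to the terminal vertex
  changes the normal by the curvature times the side, and dividing by the curvature leaves exactly
  the side. Hence both nodes next to \<open>P i\<close> lie on its normal line.\<close>

lemma evolute_node_prev:
  assumes "normalized P" "affine_curvature P (i - 1) \<noteq> 0"
  shows "evolute_node P (i - 1) = P i + (1 / affine_curvature P (i - 1)) *\<^sub>R affine_normal P i"
proof -
  let ?a = "affine_curvature P (i - 1)"
  have prev: "affine_normal P (i - 1) = affine_normal P i + ?a *\<^sub>R (P i - P (i - 1))"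
    using affine_normal_diff[OF assms(1), of "i - 1"] by (simp add: side_vec_def algebra_simps)
  show ?thesis
    unfolding evolute_node_def prev using assms(2) by (simp add: algebra_simps)
qed

lemma between_reciprocals:
  fixes a b l :: real
  assumes "a * b > 0" "(1 - l * a) * (1 - l * b) < 0"
  obtains u where "0 \<le> u" "u \<le> 1" "l = (1 - u) * (1 / a) + u * (1 / b)"
proof -
  have nz: "a \<noteq> 0" "b \<noteq> 0" and ab: "a \<noteq> b"
    using assms by (auto simp: mult_less_0_iff)
  \<comment> \<open>This is the solution of \<open>l = (1 - u) * (1 / a) + u * (1 / b)\<close> for
    \<open>u\<close>. Positivity of \<open>u * (1 - u)\<close> then places it between 0 and
    1.\<close>
  define u where "u = b * (l * a - 1) / (a - b)"
  have u': "1 - u = a * (1 - l * b) / (a - b)"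
    using ab by (simp add: u_def field_simps)
  have "u * (1 - u) = (a * b) * - ((1 - l * a) * (1 - l * b)) / (a - b)\<^sup>2"
    unfolding u' unfolding u_def times_divide_times_eq power2_eq_square
    by (rule arg_cong2[where f = "(/)"]) (simp_all add: algebra_simps)
  also have "\<dots> > 0"
    using assms ab by (intro divide_pos_pos mult_pos_pos[OF assms(1)]) auto
  finally have "0 \<le> u" "u \<le> 1"
    by (auto simp: zero_less_mult_iff)
  moreover have "l = (1 - u) * (1 / a) + u * (1 / b)"
    unfolding u' unfolding u_def using nz ab by (simp add: divide_simps) algebra
  ultimately show ?thesis by (rule that)
qed

text \<open>Substituting \<open>l\<close> gives \<open>1 - l * a = u * (b - a) / b\<close> and
  \<open>1 - l * b = (1 - u) * (a - b) / a\<close>, whose product has the sign of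
  \<open>- (a * b)\<close>.\<close>

lemma not_between_reciprocals:
  fixes a b u :: real
  assumes "a * b < 0" "0 < u" "u < 1" and l: "l = (1 - u) * (1 / a) + u * (1 / b)"
  shows "(1 - l * a) * (1 - l * b) > 0"
proof -
  have nz: "a \<noteq> 0" "b \<noteq> 0"
    using assms by auto
  then have "(1 - l * a) * (1 - l * b) = u * (1 - u) * ((b - a)\<^sup>2 / - (a * b))"
    unfolding l by (simp add: divide_simps) algebra
  also have "\<dots> > 0"
    using assms by (intro mult_pos_pos divide_pos_pos) auto
  finally show ?thesis .
qed

lemma cusp_in_evolute_edge:
  assumes P: "normalized P" and "is_cusp P l i"
  shows "parallel_polygon P l i \<in> evolute_edge P i"
proof -
  define a b where "a = affine_curvature P (i - 1)" and "b = affine_curvature P i"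
  define n where "n = affine_normal P i"
  define A B where "A = evolute_node P (i - 1)" and "B = evolute_node P i"
  have n: "n \<noteq> 0"
    using normalized_affine_normal_nonzero[OF P] by (simp add: n_def)
  \<comment> \<open>Since \<open>1 / 0 = 0\<close>, a vanishing \<open>a\<close> would make
    \<open>A\<close> the vertex \<open>P (i - 1)\<close>, so a condition is needed. The formula for
    \<open>B\<close> holds by definition even when \<open>b = 0\<close>.\<close>
  have A: "A = P i + (1 / a) *\<^sub>R n" if "a \<noteq> 0"
    using evolute_node_prev[OF P] that by (simp add: A_def a_def n_def)
  have B: "B = P i + (1 / b) *\<^sub>R n"
    by (simp add: B_def evolute_node_def b_def n_def)
  have cusp: "(1 - l * a) * (1 - l * b) < 0"
    using assms(2) by (simp add: is_cusp_iff[OF P] a_def b_def)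
  have X: "parallel_polygon P l i = P i + l *\<^sub>R n"
    by (simp add: parallel_polygon_def n_def)
  have comb: "(1 - u) *\<^sub>R (P i + s *\<^sub>R n) + u *\<^sub>R (P i + t *\<^sub>R n)
      = P i + ((1 - u) * s + u * t) *\<^sub>R n" for u s t
    by (simp add: algebra_simps)
  \<comment> \<open>The ray has direction \<open>(1 / c) *\<^sub>R n\<close>, so coordinate
    \<open>l\<close> is reached at parameter \<open>l * c - 1\<close>.\<close>
  have ray: "P i + l *\<^sub>R n \<in> ray_away (P i) (P i + (1 / c) *\<^sub>R n)"
    if "c \<noteq> 0" "1 - l * c < 0" for c
    unfolding ray_away_def using that
    by (intro CollectI exI[of _ "l * c - 1"]) (simp add: algebra_simps)
  note edge = evolute_edge_def[of P i, folded a_def b_def A_def B_def]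
  consider "a * b > 0" | "a * b < 0" | "a \<noteq> 0" "b = 0" | "a = 0"
    by (metis linorder_neqE_linordered_idom mult_eq_0_iff)
  then show ?thesis
  proof cases
    case 1
    with cusp obtain u where "0 \<le> u" "u \<le> 1" "l = (1 - u) * (1 / a) + u * (1 / b)"
      using between_reciprocals by blast
    moreover from 1 have "a \<noteq> 0"
      by auto
    ultimately have "P i + l *\<^sub>R n \<in> closed_segment A B"
      unfolding closed_segment_def A[OF \<open>a \<noteq> 0\<close>] B comb by auto
    with 1 show ?thesis
      by (simp add: edge X)
  next
    case 2
    then have "a \<noteq> 0"
      by auto
    have "P i + l *\<^sub>R n \<notin> open_segment A B"
    proof
      assume "P i + l *\<^sub>R n \<in> open_segment A B"
      then obtain u where u: "0 < u" "u < 1" "P i + l *\<^sub>R n = (1 - u) *\<^sub>R A + u *\<^sub>R B"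
        by (auto simp: in_segment)
      \<comment> \<open>As \<open>n\<close> is nonzero, points of the normal line determine their
        coordinates.\<close>
      then have "l = (1 - u) * (1 / a) + u * (1 / b)"
        unfolding A[OF \<open>a \<noteq> 0\<close>] B comb using n by simp
      with not_between_reciprocals[OF 2 u(1,2)] cusp show False
        by simp
    qed
    with 2 show ?thesis
      by (simp add: edge normal_line_def flip: X)
  next
    case 3
    then show ?thesis
      using cusp A ray[of a] by (simp add: edge X)
  next
    case 4
    \<comment> \<open>With \<open>a = 0\<close> the first cusp factor is 1. If \<open>b\<close>
      vanished too, the product would be 1, so the empty edge never arises.\<close>
    then have "b \<noteq> 0" "1 - l * b < 0"
      using cusp by auto
    with 4 show ?thesis
      using B ray[of b] by (simp add: edge X)
  qed
qed

theorem proposition5p1: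
  fixes n :: nat and P :: polygon and l :: real and i :: int
  assumes "convex_equal_area n P"
    and "normalized P"
    and "is_cusp P l i"
  shows "parallel_polygon P l i \<in> affine_evolute P"
  using cusp_in_evolute_edge[OF assms(2,3)] by (auto simp: affine_evolute_def)

end
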